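(* Assume that the energy transport matrix $\Gamma^c=(\Gamma^c_{jl})_{1\le j,l\le N}$ is irreducible. Then for every $l\in\{1,\dots,N\}$, $$\lim_{L\to+\infty}\frac1L\ln\Big[\sum_{j=1}^N\mathcal T^l_j(L)\Big]=-\Lambda_\infty,\qquad \Lambda_\infty=\inf_{X\in\mathcal S^N_+}\big\langle(-\Gamma^c+\Lambda^c_d)X,X\big\rangle_{\mathbb R^N},$$ where $\mathcal S^N_+=\{X\in\mathbb R^N:\ X_j\ge0\ \forall j,\ \langle X,X\rangle_{\mathbb R^N}=1\}$ and $\Lambda^c_d=\mathrm{diag}(\Lambda^c_1,\dots,\Lambda^c_N)$. Moreover $\Lambda_\infty>0$ as soon as one of the coefficients $\Lambda^c_j$ is positive.
   Context: **Modes.** Fix $d>0$, $n_1>1$, $k>0$ (the wavenumber at a fixed frequency), $\theta=\sqrt{1-1/n_1^2}$. Let $0<\sigma_1<\dots<\sigma_N$ be the solutions in $(0,n_1kd\theta)$ of $\tan y=-y/\sqrt{(n_1kd\theta)^2-y^2}$ (assume $N\ge1$), and put $\beta_j=\sqrt{n_1^2k^2-\sigma_j^2/d^2}>k$, $\zeta_j=d\sqrt{\beta_j^2-k^2}$. For $x\in[0,d]$ let $\phi_j(x)=A_j\sin(\sigma_jx/d)$ with $$A_j=\sqrt{\frac{2/d}{1+\frac{\sin^2\sigma_j}{\zeta_j}-\frac{\sin 2\sigma_j}{2\sigma_j}}}.$$ For $\gamma\in(0,k^2)$ let $\eta_\gamma=d\sqrt{n_1^2k^2-\gamma}$, $\xi_\gamma=d\sqrt{k^2-\gamma}$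 and, for $x\in[0,d]$, $\phi_\gamma(x)=A_\gamma\sin(\eta_\gamma x/d)$ with $$A_\gamma=\sqrt{\frac{d\,\xi_\gamma}{\pi(\xi_\gamma^2\sin^2\eta_\gamma+\eta_\gamma^2\cos^2\eta_\gamma)}}.$$ **Random field.** $V=(V(x,z))_{x\in[0,d],z\ge0}$ is a continuous real zero-mean Gaussian field with $\mathbb E[V(x,z_1)V(y,z_2)]=\gamma_0(x,y)e^{-a|z_1-z_2|}$, where $a>0$ and $\gamma_0:[0,d]^2\to\mathbb R$ is Lipschitz and is the kernel of a nonnegative operator on $L^2(0,d)$. Set $C_{jl}(z)=\int_0^d\phi_j\phi_lV(x,z)dx$ and $C_{j\gamma}(z)=\int_0^d\phi_j\phi_\gamma V(x,z)dx$. **Coefficients.** For $j\ne l$, $$\Gamma^c_{jl}=\frac{k^4}{2\beta_j\beta_l}\int_0^\infty\mathbb E[C_{jl}(0)C_{jl}(z)]\cos((\beta_l-\beta_j)z)dz\ \ (\ge0),\qquad \Gamma^c_{jj}=-\sum_{l\neq j}\Gamma^c_{jl},$$ $$\Lambda^c_j=\int_0^{k^2}\frac{k^4}{2\sqrt\gamma\,\beta_j}\int_0^\infty\mathbb E[C_{j\gamma}(0)C_{j\gamma}(z)]\cos((\sqrt\gamma-\beta_j)z)dz\,d\gamma\ \ (\ge0).$$ **Mean mode powers.** For $l\in\{1,\dots,N\}$, $(\mathcal T^l_j)_{1\le j\le N}$ are the asymptotic mean powers of the propagating modes when only mode $l$ is initially excited (with unit power); they are the solution of the coupled power equations $$\frac{d}{dz}\mathcal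 T^l_j(z)=-\Lambda^c_j\mathcal T^l_j(z)+\sum_{n\ne j}\Gamma^c_{nj}\big(\mathcal T^l_n(z)-\mathcal T^l_j(z)\big),\qquad \mathcal T^l_j(0)=\delta_{jl}.$$ *)

theory Defs
  imports "HOL-Probability.Probability"
begin

text \<open>
  The index type \<open>'n\<close> of the guided modes is an arbitrary finite linear order.  The
  theorem assumes \<open>strict_mono \<sigma>\<close> and \<open>range \<sigma> = guided_roots d n1 k\<close>, so
  that \<open>\<sigma>\<close> is the increasing enumeration of the roots and \<open>CARD('n)\<close> is the
  number of modes, which is then automatically at least one.
\<close>

definition theta :: "real \<Rightarrow> real" where
  "theta n1 = sqrt (1 - 1 / n1\<^sup>2)"

text \<open>
  At a zero of the cosine, where \<open>tan\<close> is undefined mathematically, HOL has \<open>tan y = 0\<close>;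
  the right-hand side is negative, so this adds no spurious root.
\<close>
definition guided_roots :: "real \<Rightarrow> real \<Rightarrow> real \<Rightarrow> real set" where
  "guided_roots d n1 k =
     {y \<in> {0<..<n1 * k * d * theta n1}. tan y = - y / sqrt ((n1 * k * d * theta n1)\<^sup>2 - y\<^sup>2)}"

text \<open>The quantities attached to a guided mode \<open>j\<close> are written as functions of the root
  \<open>s = \<sigma> j\<close>.\<close>

definition beta :: "real \<Rightarrow> real \<Rightarrow> real \<Rightarrow> real \<Rightarrow> real" where
  "beta d n1 k s = sqrt (n1\<^sup>2 * k\<^sup>2 - s\<^sup>2 / d\<^sup>2)"

definition zeta :: "real \<Rightarrow> real \<Rightarrow> real \<Rightarrow> real \<Rightarrow> real" where
  "zeta d n1 k s = d * sqrt ((beta d n1 k s)\<^sup>2 - k\<^sup>2)"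

definition guided_amplitude :: "real \<Rightarrow> real \<Rightarrow> real \<Rightarrow> real \<Rightarrow> real" where
  "guided_amplitude d n1 k s =
     sqrt ((2 / d) / (1 + (sin s)\<^sup>2 / zeta d n1 k s - sin (2 * s) / (2 * s)))"

definition guided_mode :: "real \<Rightarrow> real \<Rightarrow> real \<Rightarrow> real \<Rightarrow> real \<Rightarrow> real" where
  "guided_mode d n1 k s x = guided_amplitude d n1 k s * sin (s * x / d)"

definition eta :: "real \<Rightarrow> real \<Rightarrow> real \<Rightarrow> real \<Rightarrow> real" where
  "eta d n1 k \<gamma> = d * sqrt (n1\<^sup>2 * k\<^sup>2 - \<gamma>)"

definition xi :: "real \<Rightarrow> real \<Rightarrow> real \<Rightarrow> real" where
  "xi d k \<gamma> = d * sqrt (k\<^sup>2 - \<gamma>)"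

definition radiating_amplitude :: "real \<Rightarrow> real \<Rightarrow> real \<Rightarrow> real \<Rightarrow> real" where
  "radiating_amplitude d n1 k \<gamma> =
     sqrt (d * xi d k \<gamma> /
       (pi * ((xi d k \<gamma>)\<^sup>2 * (sin (eta d n1 k \<gamma>))\<^sup>2
              + (eta d n1 k \<gamma>)\<^sup>2 * (cos (eta d n1 k \<gamma>))\<^sup>2)))"

definition radiating_mode :: "real \<Rightarrow> real \<Rightarrow> real \<Rightarrow> real \<Rightarrow> real \<Rightarrow> real" where
  "radiating_mode d n1 k \<gamma> x = radiating_amplitude d n1 k \<gamma> * sin (eta d n1 k \<gamma> * x / d)"

text \<open>Degenerate (almost surely constant) variables count as Gaussian.\<close>
definition gaussian_rv :: "'w measure \<Rightarrow> ('w \<Rightarrow> real) \<Rightarrow> bool" where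
  "gaussian_rv M X \<longleftrightarrow>
     X \<in> borel_measurable M \<and>
     (\<exists>\<mu>. (AE \<omega> in M. X \<omega> = \<mu>) \<or>
          (\<exists>s>0. distributed M lborel X (\<lambda>x. ennreal (normal_density \<mu> s x))))"

definition gaussian_field :: "'w measure \<Rightarrow> 'p set \<Rightarrow> ('p \<Rightarrow> 'w \<Rightarrow> real) \<Rightarrow> bool" where
  "gaussian_field M D W \<longleftrightarrow>
     (\<forall>F c. finite F \<and> F \<subseteq> D \<longrightarrow> gaussian_rv M (\<lambda>\<omega>. \<Sum>p\<in>F. c p * W p \<omega>))"

definition nonneg_operator_kernel :: "real \<Rightarrow> (real \<Rightarrow> real \<Rightarrow> real) \<Rightarrow> bool" where
  "nonneg_operator_kernel d K \<longleftrightarrow>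
     (\<forall>x\<in>{0..d}. \<forall>y\<in>{0..d}. K x y = K y x) \<and>
     (\<forall>f\<in>borel_measurable lborel. set_integrable lborel {0..d} (\<lambda>x. (f x)\<^sup>2) \<longrightarrow>
        0 \<le> (LINT x:{0..d}|lborel. (LINT y:{0..d}|lborel. K x y * f y) * f x))"

text \<open>
  \<open>V x z \<omega>\<close> is the value at transverse coordinate \<open>x\<close> and range \<open>z\<close>; only
  \<open>x \<in> [0,d]\<close>, \<open>z \<ge> 0\<close> matters.  Continuity is required of every sample path.
\<close>
definition random_field ::
  "'w measure \<Rightarrow> real \<Rightarrow> real \<Rightarrow> (real \<Rightarrow> real \<Rightarrow> real) \<Rightarrow> (real \<Rightarrow> real \<Rightarrow> 'w \<Rightarrow> real) \<Rightarrow> bool" where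
  "random_field M d a \<gamma>0 V \<longleftrightarrow>
     prob_space M \<and>
     (\<forall>\<omega>\<in>space M. continuous_on ({0..d} \<times> {0..}) (\<lambda>(x, z). V x z \<omega>)) \<and>
     gaussian_field M ({0..d} \<times> {0..}) (\<lambda>(x, z). V x z) \<and>
     (\<forall>x\<in>{0..d}. \<forall>z\<ge>0. prob_space.expectation M (V x z) = 0) \<and>
     (\<forall>x\<in>{0..d}. \<forall>y\<in>{0..d}. \<forall>z1\<ge>0. \<forall>z2\<ge>0.
        prob_space.expectation M (\<lambda>\<omega>. V x z1 \<omega> * V y z2 \<omega>) = \<gamma>0 x y * exp (- a * \<bar>z1 - z2\<bar>)) \<and>
     a > 0 \<and>
     (\<exists>C. C-lipschitz_on ({0..d} \<times> {0..d}) (\<lambda>(x, y). \<gamma>0 x y)) \<and>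
     nonneg_operator_kernel d \<gamma>0"

definition coupling ::
  "real \<Rightarrow> (real \<Rightarrow> real \<Rightarrow> 'w \<Rightarrow> real) \<Rightarrow> (real \<Rightarrow> real) \<Rightarrow> (real \<Rightarrow> real) \<Rightarrow> real \<Rightarrow> 'w \<Rightarrow> real" where
  "coupling d V f g z \<omega> = (LINT x:{0..d}|lborel. f x * g x * V x z \<omega>)"

definition coupling_spectrum ::
  "'w measure \<Rightarrow> real \<Rightarrow> (real \<Rightarrow> real \<Rightarrow> 'w \<Rightarrow> real) \<Rightarrow> (real \<Rightarrow> real) \<Rightarrow> (real \<Rightarrow> real) \<Rightarrow> real \<Rightarrow> real"
  where
  "coupling_spectrum M d V f g q =
     (LINT z:{0..}|lborel.
        prob_space.expectation M (\<lambda>\<omega>. coupling d V f g 0 \<omega> * coupling d V f g z \<omega>) * cos (q * z))"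

definition transport_rate ::
  "real \<Rightarrow> real \<Rightarrow> real \<Rightarrow> ('n::finite \<Rightarrow> real) \<Rightarrow> 'w measure \<Rightarrow> (real \<Rightarrow> real \<Rightarrow> 'w \<Rightarrow> real) \<Rightarrow>
     'n \<Rightarrow> 'n \<Rightarrow> real" where
  "transport_rate d n1 k \<sigma> M V j l =
     k ^ 4 / (2 * beta d n1 k (\<sigma> j) * beta d n1 k (\<sigma> l)) *
     coupling_spectrum M d V (guided_mode d n1 k (\<sigma> j)) (guided_mode d n1 k (\<sigma> l))
       (beta d n1 k (\<sigma> l) - beta d n1 k (\<sigma> j))"

definition Gamma_c ::
  "real \<Rightarrow> real \<Rightarrow> real \<Rightarrow> ('n::finite \<Rightarrow> real) \<Rightarrow> 'w measure \<Rightarrow> (real \<Rightarrow> real \<Rightarrow> 'w \<Rightarrow> real) \<Rightarrow>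
     real ^ 'n ^ 'n" where
  "Gamma_c d n1 k \<sigma> M V =
     (\<chi> j l. if j = l then - (\<Sum>m\<in>UNIV - {j}. transport_rate d n1 k \<sigma> M V j m)
             else transport_rate d n1 k \<sigma> M V j l)"

definition Lambda_c ::
  "real \<Rightarrow> real \<Rightarrow> real \<Rightarrow> ('n::finite \<Rightarrow> real) \<Rightarrow> 'w measure \<Rightarrow> (real \<Rightarrow> real \<Rightarrow> 'w \<Rightarrow> real) \<Rightarrow>
     real ^ 'n" where
  "Lambda_c d n1 k \<sigma> M V =
     (\<chi> j. LINT \<gamma>:{0<..<k\<^sup>2}|lborel.
        k ^ 4 / (2 * sqrt \<gamma> * beta d n1 k (\<sigma> j)) *
        coupling_spectrum M d V (guided_mode d n1 k (\<sigma> j)) (radiating_mode d n1 k \<gamma>)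
          (sqrt \<gamma> - beta d n1 k (\<sigma> j)))"

definition solves_coupled_power_equations ::
  "real ^ 'n ^ 'n \<Rightarrow> real ^ 'n \<Rightarrow> 'n::finite \<Rightarrow> (real \<Rightarrow> real ^ 'n) \<Rightarrow> bool" where
  "solves_coupled_power_equations \<Gamma> \<Lambda> l T \<longleftrightarrow>
     (\<forall>j. T 0 $ j = (if j = l then 1 else 0)) \<and>
     (\<forall>z\<ge>0. \<forall>j. ((\<lambda>z. T z $ j) has_real_derivative
        (- \<Lambda> $ j * T z $ j + (\<Sum>n\<in>UNIV - {j}. \<Gamma> $ n $ j * (T z $ n - T z $ j))))
        (at z within {0..}))"

text \<open>A matrix is reducible if the indices split into two nonempty classes such that all
  entries from the first class to the second vanish, i.e. if a simultaneous permutation of rows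
  and columns makes it block triangular; a one-by-one matrix is irreducible.\<close>
definition irreducible_matrix :: "real ^ 'n ^ 'n \<Rightarrow> bool" where
  "irreducible_matrix A \<longleftrightarrow>
     \<not> (\<exists>S. S \<noteq> {} \<and> S \<noteq> UNIV \<and> (\<forall>i\<in>S. \<forall>j\<in>- S. A $ i $ j = 0))"

definition diag_matrix :: "real ^ 'n \<Rightarrow> real ^ 'n ^ 'n" where
  "diag_matrix v = (\<chi> i j. if i = j then v $ i else 0)"

definition nonneg_sphere :: "(real ^ 'n) set" where
  "nonneg_sphere = {X. (\<forall>j. X $ j \<ge> 0) \<and> X \<bullet> X = 1}"

definition Lambda_inf :: "real ^ 'n ^ 'n \<Rightarrow> real ^ 'n \<Rightarrow> real" where
  "Lambda_inf \<Gamma> \<Lambda> = (INF X\<in>nonneg_sphere. ((- \<Gamma> + diag_matrix \<Lambda>) *v X) \<bullet> X)"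

end

theory Submission
  imports Defs
begin

text \<open>
  The matrix \<open>A = \<Gamma> - diag \<Lambda>\<close> is symmetric with nonnegative off-diagonal entries, so
  replacing \<open>y\<close> by its entrywise absolute value can only increase \<open>\<langle>A y, y\<rangle>\<close>.  A minimiser \<open>x\<close> of
  \<open>\<langle>- A x, x\<rangle>\<close> over the nonnegative part of the sphere therefore minimises over the whole sphere
  and is an eigenvector for \<open>\<mu> = - \<Lambda>\<^sub>\<infinity>\<close>; irreducibility makes it entrywise positive.
  Along a solution \<open>u\<close> of the power equations \<open>\<langle>x, u\<rangle>\<close> is a multiple of \<open>exp (\<mu> z)\<close>, and it is
  comparable to \<open>\<Sum> u\<^sub>j\<close> because \<open>u\<close> stays nonnegative.  Since the columns of \<open>\<Gamma>\<close> sum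
  to zero, summing the eigenvalue equation gives \<open>\<mu> \<Sum> x\<^sub>j = - \<Sum> \<Lambda>\<^sub>j x\<^sub>j\<close>, hence the
  sign of \<open>\<Lambda>\<^sub>\<infinity>\<close>.  The signs of the coefficients come from the random field: by Fubini each
  spectrum is the value of the quadratic form of \<open>\<gamma>0\<close> at the product of the two modes times
  \<open>\<integral> exp (- a z) cos (q z) dz = a / (a\<^sup>2 + q\<^sup>2)\<close>.
\<close>

section \<open>Symmetric matrices with nonnegative off-diagonal entries\<close>

lemma symmetric_inner_matrix:
  fixes A :: "real ^ 'n ^ 'n"
  assumes "transpose A = A"
  shows "(A *v x) \<bullet> y = x \<bullet> (A *v y)"
  by (metis assms dot_lmul_matrix vector_transpose_matrix)

lemma inner_matrix_sum:
  fixes A :: "real ^ 'n ^ 'n"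
  shows "(A *v x) \<bullet> y = (\<Sum>i\<in>UNIV. \<Sum>j\<in>UNIV. A $ i $ j * x $ j * y $ i)"
  by (simp add: inner_vec_def matrix_vector_mult_def sum_distrib_right)

text \<open>Along \<open>x - t *\<^sub>R y\<close> with \<open>y = B *v x\<close> the form equals
  \<open>t * t * c - 2 * t * p\<close>, where \<open>p\<close> is the squared norm of
  \<open>y\<close>. The linear term would make this negative for small positive \<open>t\<close>, so
  semidefiniteness forces \<open>p = 0\<close>.\<close>

lemma psd_null_vector:
  fixes B :: "real ^ 'n ^ 'n"
  assumes sym: "transpose B = B"
    and psd: "\<And>y. 0 \<le> (B *v y) \<bullet> y"
    and null: "(B *v x) \<bullet> x = 0"
  shows "B *v x = 0"
proof -
  define y where "y = B *v x"
  define p where "p = y \<bullet> y"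
  define c where "c = (B *v y) \<bullet> y"
  \<comment> \<open>The minimising step would be \<open>p / c\<close>; adding 1 keeps the
    denominator positive when \<open>c = 0\<close> and still makes the form equal to
    \<open>- (t * t * (c + 2))\<close>.\<close>
  define t where "t = p / (c + 1)"
  have c: "c \<ge> 0" using psd[of y] by (simp add: c_def)
  have "(B *v (x - t *\<^sub>R y)) \<bullet> (x - t *\<^sub>R y)
      = (B *v x) \<bullet> x - t * ((B *v x) \<bullet> y) - t * ((B *v y) \<bullet> x) + t * t * c"
    by (simp add: c_def algebra_simps)
  moreover have "(B *v y) \<bullet> x = p"
    by (simp add: symmetric_inner_matrix[OF sym] p_def y_def)
  moreover have "(B *v x) \<bullet> y = p" by (simp add: p_def y_def)
  ultimately have "0 \<le> t * t * c - t * p - t * p"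
    using psd[of "x - t *\<^sub>R y"] null by simp
  moreover have tc: "t * (c + 1) = p" using c by (simp add: t_def)
  have "t * t * c - t * p - t * p = - (t * t * (c + 2))"
    unfolding tc[symmetric] by (simp add: algebra_simps)
  ultimately have "t * t * (c + 2) \<le> 0" by simp
  hence "t = 0" using c
    by (smt (verit) mult_pos_pos zero_less_mult_iff mult_neg_neg)
  hence "p = 0" using tc by simp
  thus ?thesis by (simp add: p_def y_def)
qed

lemma compact_nonneg_sphere: "compact (nonneg_sphere :: (real ^ 'n) set)"
proof -
  have "nonneg_sphere = sphere 0 1 \<inter> (\<Inter>j. {X :: real ^ 'n. 0 \<le> X $ j})"
    by (auto simp: nonneg_sphere_def norm_eq_1)
  moreover have "closed (\<Inter>j. {X :: real ^ 'n. 0 \<le> X $ j})"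
    by (intro closed_INT ballI closed_Collect_le continuous_intros)
  ultimately show ?thesis by (metis compact_Int_closed compact_sphere)
qed

lemma nonneg_sphere_nonempty: "(nonneg_sphere :: (real ^ 'n) set) \<noteq> {}"
proof -
  obtain i :: 'n where True by simp
  have "axis i 1 \<in> (nonneg_sphere :: (real ^ 'n) set)"
    unfolding nonneg_sphere_def by (simp add: inner_axis_axis) (simp add: axis_def)
  thus ?thesis by blast
qed

text \<open>The variational form of the Perron theorem. The bound on the quadratic form is exported
  with the eigenvector because the energy estimate for the flow relies on it.\<close>

lemma perron_eigenvector:
  fixes A :: "real ^ 'n ^ 'n"
  assumes sym: "transpose A = A"
    and metzler: "\<And>i j. i \<noteq> j \<Longrightarrow> 0 \<le> A $ i $ j"
    and irr: "irreducible_matrix A"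
  defines "\<mu> \<equiv> - (INF X\<in>nonneg_sphere. ((- A) *v X) \<bullet> X)"
  obtains x where "\<And>j. 0 < x $ j" "A *v x = \<mu> *\<^sub>R x" "\<And>y. (A *v y) \<bullet> y \<le> \<mu> * (y \<bullet> y)"
proof -
  let ?q = "\<lambda>X. ((- A) *v X) \<bullet> X"
  have neg: "?q X = - ((A *v X) \<bullet> X)" for X
    by (simp add: inner_matrix_sum sum_negf)
  have "continuous_on nonneg_sphere ?q"
    unfolding inner_matrix_sum by (intro continuous_intros)
  from continuous_attains_inf[OF compact_nonneg_sphere nonneg_sphere_nonempty this]
  obtain x where x: "x \<in> nonneg_sphere" and min: "\<And>y. y \<in> nonneg_sphere \<Longrightarrow> ?q x \<le> ?q y"
    by blast
  have "(INF X\<in>nonneg_sphere. ?q X) = ?q x"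
    using x min by (intro cInf_eq_minimum) auto
  hence \<mu>: "\<mu> = (A *v x) \<bullet> x" by (simp add: \<mu>_def neg)
  have xx: "x \<bullet> x = 1" and x0: "\<And>j. 0 \<le> x $ j" using x by (auto simp: nonneg_sphere_def)
  have bound: "(A *v y) \<bullet> y \<le> \<mu> * (y \<bullet> y)" for y
  proof (cases "y = 0")
    case False
    define r where "r = norm y"
    have r: "r > 0" using False by (simp add: r_def)
    define w where "w = (\<chi> j. \<bar>y $ j\<bar>)"
    have ww: "w \<bullet> w = r\<^sup>2"
      by (simp add: r_def w_def inner_vec_def norm_vec_def L2_set_def sum_nonneg power2_eq_square)
    \<comment> \<open>Diagonal terms have either sign but contain squares, so they agree for
      \<open>y\<close> and \<open>w\<close>; only the off-diagonal terms can grow.\<close>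
    have "(A *v y) \<bullet> y \<le> (A *v w) \<bullet> w"
      unfolding inner_matrix_sum
    proof (intro sum_mono)
      fix i j
      show "A $ i $ j * y $ j * y $ i \<le> A $ i $ j * w $ j * w $ i"
      proof (cases "i = j")
        case False
        have "y $ j * y $ i \<le> w $ j * w $ i" by (simp add: w_def abs_mult[symmetric])
        from mult_left_mono[OF this metzler[OF False]] show ?thesis by (simp add: mult.assoc)
      qed (simp add: w_def)
    qed
    also have "(A *v w) \<bullet> w \<le> \<mu> * r\<^sup>2"
    proof -
      have "(1 / r) *\<^sub>R w \<in> nonneg_sphere"
        using r ww by (simp add: nonneg_sphere_def) (simp add: w_def power2_eq_square)
      from min[OF this] have "(A *v w) \<bullet> w / r\<^sup>2 \<le> \<mu>"
        by (simp add: neg \<mu> matrix_vector_mult_scaleR power2_eq_square)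
      thus ?thesis using r by (simp add: field_simps)
    qed
    finally show ?thesis by (simp add: r_def power2_norm_eq_inner)
  qed simp
  \<comment> \<open>\<open>bound\<close> says that \<open>B\<close> is positive semidefinite, and
    its form vanishes at the minimiser, so \<open>x\<close> lies in the kernel of
    \<open>B\<close>.\<close>
  define B where "B = mat \<mu> - A"
  have B: "B *v y = \<mu> *\<^sub>R y - A *v y" for y
  proof -
    have "mat \<mu> *v y = \<mu> *\<^sub>R y"
      by (simp add: vec_eq_iff matrix_vector_mult_def mat_def if_distrib[of "\<lambda>a. a * _"] cong: if_cong)
    thus ?thesis by (simp add: B_def matrix_vector_mult_diff_rdistrib)
  qed
  have "B *v x = 0"
  proof (rule psd_null_vector)
    show "transpose B = B" using sym by (simp add: B_def transpose_def mat_def vec_eq_iff)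
    show "0 \<le> (B *v y) \<bullet> y" for y using bound[of y] by (simp add: B inner_diff_left)
    show "(B *v x) \<bullet> x = 0" by (simp add: B inner_diff_left \<mu> xx)
  qed
  hence eig: "A *v x = \<mu> *\<^sub>R x" by (simp add: B)
  have "0 < x $ j" for j
  proof -
    \<comment> \<open>If \<open>x $ i = 0\<close>, row \<open>i\<close> of the eigenvalue equation
      is a vanishing sum of nonnegative terms: the diagonal entry, whose sign is unknown, is
      multiplied by \<open>x $ i\<close>. Hence no entry of \<open>A\<close> leads from
      \<open>?S\<close> to its complement.\<close>
    let ?S = "{i. x $ i = 0}"
    have "A $ i $ j = 0" if "i \<in> ?S" "j \<in> - ?S" for i j
    proof -
      have "(\<Sum>n\<in>UNIV. A $ i $ n * x $ n) = 0"
        using eig that by (simp add: vec_eq_iff matrix_vector_mult_def)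
      moreover have "0 \<le> A $ i $ n * x $ n" for n
        using metzler[of i n] x0[of n] that by (cases "n = i") auto
      ultimately have "A $ i $ j * x $ j = 0"
        by (simp add: sum_nonneg_eq_0_iff)
      thus ?thesis using that by simp
    qed
    hence "?S = {} \<or> ?S = UNIV" using irr unfolding irreducible_matrix_def by blast
    moreover have "?S \<noteq> UNIV"
    proof
      assume "?S = UNIV"
      hence "x = 0" by (auto simp: vec_eq_iff)
      thus False using xx by simp
    qed
    ultimately show ?thesis using x0[of j] by (auto simp: order_less_le)
  qed
  thus ?thesis using eig bound that by blast
qed

text \<open>Squaring removes the kink of the negative part at 0, so the energy of a solution can be
  differentiated across sign changes of its entries.\<close>

lemma has_real_derivative_neg_part_squared:
  "((\<lambda>t::real. (min t 0)\<^sup>2) has_real_derivative 2 * min t 0) (at t)"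
proof (cases "t = 0")
  case True
  have "(\<lambda>h. ((min (0 + h) 0)\<^sup>2 - (min (0::real) 0)\<^sup>2) / h) \<midarrow>0\<rightarrow> 0"
  proof (rule Lim_null_comparison)
    show "\<forall>\<^sub>F h in at 0. norm (((min (0 + h) 0)\<^sup>2 - (min (0::real) 0)\<^sup>2) / h) \<le> \<bar>h\<bar>"
      by (intro always_eventually allI) (auto simp: min_def power2_eq_square)
    show "((\<lambda>h::real. \<bar>h\<bar>) \<longlongrightarrow> 0) (at 0)" by (auto intro!: tendsto_eq_intros)
  qed
  thus ?thesis using True by (simp add: DERIV_def)
next
  case False
  show ?thesis
  proof (cases "t < 0")
    case True
    have "((\<lambda>t::real. t\<^sup>2) has_real_derivative 2 * min t 0) (at t)"
      using True by (auto intro!: derivative_eq_intros)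
    thus ?thesis
      by (rule has_field_derivative_transform_within_open[of _ _ _ "{..<0}"]) (use True in auto)
  next
    case f: False
    have "((\<lambda>t::real. 0) has_real_derivative 2 * min t 0) (at t)"
      using f False by auto
    thus ?thesis
      by (rule has_field_derivative_transform_within_open[of _ _ _ "{0<..}"]) (use f False in auto)
  qed
qed

text \<open>The squared norm of the negative part of the solution, damped by \<open>exp (- 2 \<mu> z)\<close>, is
  nonincreasing.\<close>
lemma metzler_flow_nonneg:
  fixes A :: "real ^ 'n ^ 'n" and u :: "real \<Rightarrow> real ^ 'n"
  assumes metzler: "\<And>i j. i \<noteq> j \<Longrightarrow> 0 \<le> A $ i $ j"
    and form: "\<And>y. (A *v y) \<bullet> y \<le> \<mu> * (y \<bullet> y)"
    and ode: "\<And>z j. 0 \<le> z \<Longrightarrow> ((\<lambda>z. u z $ j) has_real_derivative (A *v u z) $ j) (at z within {0..})"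
    and init: "\<And>j. 0 \<le> u 0 $ j"
    and "0 \<le> z"
  shows "0 \<le> u z $ j"
proof -
  define m where "m z = (\<chi> j. min (u z $ j) 0)" for z
  define E where "E z = exp (- 2 * \<mu> * z) * (m z \<bullet> m z)" for z
  have dE: "(E has_real_derivative
      exp (- 2 * \<mu> * z) * (2 * ((A *v u z) \<bullet> m z) - 2 * \<mu> * (m z \<bullet> m z))) (at z within {0..})"
    if "0 \<le> z" for z
  proof -
    have "((\<lambda>z. (min (u z $ j) 0)\<^sup>2) has_real_derivative 2 * min (u z $ j) 0 * (A *v u z) $ j)
        (at z within {0..})" for j
      by (rule DERIV_chain2[OF has_real_derivative_neg_part_squared ode[OF that]])
    hence "((\<lambda>z. \<Sum>j\<in>UNIV. (min (u z $ j) 0)\<^sup>2) has_real_derivative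
        (\<Sum>j\<in>UNIV. 2 * min (u z $ j) 0 * (A *v u z) $ j)) (at z within {0..})"
      by (intro DERIV_sum)
    hence "((\<lambda>z. m z \<bullet> m z) has_real_derivative 2 * ((A *v u z) \<bullet> m z)) (at z within {0..})"
      by (simp add: m_def inner_vec_def power2_eq_square sum_distrib_left mult_ac)
    thus ?thesis unfolding E_def
      by (auto intro!: derivative_eq_intros simp: algebra_simps)
  qed
  \<comment> \<open>Since \<open>m z $ j\<close> is at most \<open>u z $ j\<close> and
    \<open>m z $ i\<close> is nonpositive, replacing \<open>u\<close> by \<open>m\<close> raises
    each off-diagonal product. On the diagonal the two agree wherever \<open>m z $ i\<close> is
    nonzero.\<close>
  have le: "(A *v u z) \<bullet> m z \<le> (A *v m z) \<bullet> m z" for z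
    unfolding inner_matrix_sum
  proof (intro sum_mono)
    fix i j
    show "A $ i $ j * u z $ j * m z $ i \<le> A $ i $ j * m z $ j * m z $ i"
    proof (cases "i = j")
      case False
      have "u z $ j * m z $ i \<le> m z $ j * m z $ i"
        by (rule mult_right_mono_neg) (auto simp: m_def)
      from mult_left_mono[OF this metzler[OF False]] show ?thesis by (simp add: mult.assoc)
    qed (auto simp: m_def min_def)
  qed
  have "E z \<le> E 0"
  proof (rule DERIV_nonpos_imp_decreasing_open[OF \<open>0 \<le> z\<close>])
    have "continuous_on {0..} E"
      by (rule DERIV_continuous_on) (use dE in auto)
    thus "continuous_on {0..z} E" by (rule continuous_on_subset) auto
  next
    fix s assume s: "0 < s" "s < z"
    \<comment> \<open>The one-sided derivative is two-sided away from 0; \<open>-1\<close> is the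
      point below 0 that \<open>interior_Ici\<close> asks for.\<close>
    have "at s within {0..} = at s" using s by (intro at_within_interior) (simp add: interior_Ici[of "-1"])
    hence "(E has_real_derivative
      exp (- 2 * \<mu> * s) * (2 * ((A *v u s) \<bullet> m s) - 2 * \<mu> * (m s \<bullet> m s))) (at s)"
      using dE[of s] s by simp
    moreover have "exp (- 2 * \<mu> * s) * (2 * ((A *v u s) \<bullet> m s) - 2 * \<mu> * (m s \<bullet> m s)) \<le> 0"
      using le[of s] form[of "m s"] by (intro mult_nonneg_nonpos) auto
    ultimately show "\<exists>y. (E has_real_derivative y) (at s) \<and> y \<le> 0" by blast
  qed
  moreover have "m 0 = 0" using init by (simp add: m_def vec_eq_iff min_def) (metis order_antisym)
  ultimately have "exp (- 2 * \<mu> * z) * (m z \<bullet> m z) \<le> 0" by (simp add: E_def)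
  hence "m z \<bullet> m z \<le> 0" by (simp add: mult_le_0_iff)
  hence "m z = 0" by (metis inner_ge_zero inner_eq_zero_iff order_antisym)
  hence "m z $ j = 0" by simp
  thus ?thesis by (simp add: m_def min_def split: if_splits)
qed

text \<open>Every nonzero nonnegative initial vector has a positive component along the positive
  eigenvector, so all of them grow at the same exponential rate \<open>\<mu>\<close>.\<close>

lemma metzler_flow_growth_rate:
  fixes A :: "real ^ 'n ^ 'n" and u :: "real \<Rightarrow> real ^ 'n"
  assumes sym: "transpose A = A"
    and metzler: "\<And>i j. i \<noteq> j \<Longrightarrow> 0 \<le> A $ i $ j"
    and pos: "\<And>j. 0 < x $ j" and eig: "A *v x = \<mu> *\<^sub>R x"
    and form: "\<And>y. (A *v y) \<bullet> y \<le> \<mu> * (y \<bullet> y)"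
    and ode: "\<And>z j. 0 \<le> z \<Longrightarrow> ((\<lambda>z. u z $ j) has_real_derivative (A *v u z) $ j) (at z within {0..})"
    and init: "\<And>j. 0 \<le> u 0 $ j" "u 0 \<noteq> 0"
  shows "((\<lambda>L. 1 / L * ln (\<Sum>j\<in>UNIV. u L $ j)) \<longlongrightarrow> \<mu>) at_top"
proof -
  have u0: "0 \<le> u z $ j" if "0 \<le> z" for z j
    by (rule metzler_flow_nonneg[OF metzler form ode init(1) that])
  define c where "c = x \<bullet> u 0"
  obtain j0 where j0: "u 0 $ j0 \<noteq> 0" using init(2) by (auto simp: vec_eq_iff)
  have c: "c > 0" unfolding c_def inner_vec_def inner_real_def
  proof (rule sum_pos2[of _ j0])
    show "0 < x $ j0 * u 0 $ j0" using pos[of j0] init(1)[of j0] j0 by simp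
    show "0 \<le> x $ i * u 0 $ i" for i using pos[of i] init(1)[of i] by simp
  qed auto
  \<comment> \<open>By symmetry the derivative of \<open>x \<bullet> u z\<close> is
    \<open>\<mu> * (x \<bullet> u z)\<close>, a scalar equation solved by showing that the product
    with \<open>exp (- \<mu> * z)\<close> is constant.\<close>
  have w: "x \<bullet> u z = c * exp (\<mu> * z)" if z: "0 \<le> z" for z
  proof -
    have "((\<lambda>z. exp (- \<mu> * z) * (x \<bullet> u z)) has_real_derivative 0) (at s within {0..})"
      if s: "s \<in> {0..}" for s
    proof -
      have "((\<lambda>z. \<Sum>j\<in>UNIV. x $ j * u z $ j) has_real_derivative
          (\<Sum>j\<in>UNIV. x $ j * (A *v u s) $ j)) (at s within {0..})"
        using s by (intro DERIV_sum DERIV_cmult ode) auto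
      hence "((\<lambda>z. x \<bullet> u z) has_real_derivative x \<bullet> (A *v u s)) (at s within {0..})"
        by (simp add: inner_vec_def)
      also have "x \<bullet> (A *v u s) = \<mu> * (x \<bullet> u s)"
        by (simp add: symmetric_inner_matrix[OF sym, symmetric] eig)
      finally show ?thesis by (auto intro!: derivative_eq_intros simp: algebra_simps)
    qed
    then obtain C where C: "\<And>s. s \<in> {0..} \<Longrightarrow> exp (- \<mu> * s) * (x \<bullet> u s) = C"
      using has_field_derivative_zero_constant[of "{0::real..}" "\<lambda>z. exp (- \<mu> * z) * (x \<bullet> u z)"]
      by auto
    have "exp (- \<mu> * z) * (x \<bullet> u z) = c" using C[of 0] C[of z] z by (simp add: c_def)
    thus ?thesis by (simp add: exp_minus field_simps)
  qed
  \<comment> \<open>With finitely many positive entries, \<open>x\<close> lies between two positive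
    constants. They affect \<open>ln (S z)\<close> only by a bounded amount, which disappears after
    division by \<open>z\<close>.\<close>
  define lo hi where "lo = Min (range (($) x))" and "hi = Max (range (($) x))"
  have lo: "lo > 0" using pos by (auto simp: lo_def)
  have lohi: "lo \<le> x $ j" "x $ j \<le> hi" for j by (auto simp: lo_def hi_def)
  have hi: "hi > 0" using pos lohi(2) by (meson less_le_trans)
  define S where "S z = (\<Sum>j\<in>UNIV. u z $ j)" for z
  have S1: "lo * S z \<le> c * exp (\<mu> * z)" and S2: "c * exp (\<mu> * z) \<le> hi * S z" if z: "0 \<le> z" for z
    unfolding w[OF z, symmetric] S_def inner_vec_def sum_distrib_left inner_real_def
    using lohi u0[OF z] by (auto intro!: sum_mono mult_right_mono)
  have low: "\<mu> + ln (c / hi) / z \<le> 1 / z * ln (S z)"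
    and upp: "1 / z * ln (S z) \<le> \<mu> + ln (c / lo) / z" if z: "0 < z" for z
  proof -
    have "0 < c * exp (\<mu> * z)" using c by simp
    hence Sp: "S z > 0" using S2[of z] z hi by (smt (verit) mult_nonneg_nonpos)
    have ln': "ln (c / r * exp (\<mu> * z)) = ln (c / r) + \<mu> * z" if "r > 0" for r
      using c that ln_mult_pos[of "c / r" "exp (\<mu> * z)"] by (simp del: times_divide_eq_left)
    have "c / hi * exp (\<mu> * z) \<le> S z" using S2[of z] z hi by (simp add: field_simps)
    hence "ln (c / hi) + \<mu> * z \<le> ln (S z)"
      using c hi Sp unfolding ln'[OF hi, symmetric] by (subst ln_le_cancel_iff) auto
    hence "(ln (c / hi) + \<mu> * z) / z \<le> ln (S z) / z" using z by (intro divide_right_mono) auto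
    thus "\<mu> + ln (c / hi) / z \<le> 1 / z * ln (S z)" using z by (simp add: add_divide_distrib)
    have "S z \<le> c / lo * exp (\<mu> * z)" using S1[of z] z lo by (simp add: field_simps)
    hence "ln (S z) \<le> ln (c / lo) + \<mu> * z"
      using c lo Sp unfolding ln'[OF lo, symmetric] by (subst ln_le_cancel_iff) auto
    hence "ln (S z) / z \<le> (ln (c / lo) + \<mu> * z) / z" using z by (intro divide_right_mono) auto
    thus "1 / z * ln (S z) \<le> \<mu> + ln (c / lo) / z" using z by (simp add: add_divide_distrib)
  qed
  have lim: "((\<lambda>z. \<mu> + b / z) \<longlongrightarrow> \<mu>) at_top" for b :: real
    by (rule tendsto_eq_intros tendsto_divide_0 tendsto_const filterlim_at_top_imp_at_infinity
        filterlim_ident | simp)+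
  show ?thesis
    unfolding S_def[symmetric]
  proof (rule tendsto_sandwich[OF _ _ lim lim])
    show "\<forall>\<^sub>F z in at_top. \<mu> + ln (c / hi) / z \<le> 1 / z * ln (S z)"
      using eventually_gt_at_top[of 0] by eventually_elim (rule low)
    show "\<forall>\<^sub>F z in at_top. 1 / z * ln (S z) \<le> \<mu> + ln (c / lo) / z"
      using eventually_gt_at_top[of 0] by eventually_elim (rule upp)
  qed
qed

section \<open>The spectrum of the mode coupling\<close>

text \<open>Square integrability has to be extracted from Gaussianity: the second-moment hypotheses on
  the field say nothing about it, since the integral of a non-integrable function is \<open>0\<close>.\<close>
lemma gaussian_rv_square_integrable:
  assumes "prob_space M" and g: "gaussian_rv M X"
  shows "integrable M (\<lambda>\<omega>. (X \<omega>)\<^sup>2)"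
proof -
  interpret prob_space M by fact
  have X [measurable]: "X \<in> borel_measurable M" using g by (simp add: gaussian_rv_def)
  obtain \<mu> where "(AE \<omega> in M. X \<omega> = \<mu>) \<or>
      (\<exists>s>0. distributed M lborel X (\<lambda>x. ennreal (normal_density \<mu> s x)))"
    using g unfolding gaussian_rv_def by blast
  thus ?thesis
  proof (elim disjE exE conjE)
    assume "AE \<omega> in M. X \<omega> = \<mu>"
    hence "AE \<omega> in M. (X \<omega>)\<^sup>2 = \<mu>\<^sup>2" by eventually_elim simp
    hence "integrable M (\<lambda>\<omega>. (X \<omega>)\<^sup>2) \<longleftrightarrow> integrable M (\<lambda>\<omega>. \<mu>\<^sup>2)"
      by (intro integrable_cong_AE) auto
    thus ?thesis by simp
  next
    fix s :: real assume s: "s > 0"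
      and D: "distributed M lborel X (\<lambda>x. ennreal (normal_density \<mu> s x))"
    have "integrable lborel (\<lambda>x. normal_density \<mu> s x * (x - \<mu>)\<^sup>2
        + 2 * \<mu> * (normal_density \<mu> s x * (x - \<mu>) ^ 1) + \<mu>\<^sup>2 * (normal_density \<mu> s x * (x - \<mu>) ^ 0))"
      by (intro Bochner_Integration.integrable_add integrable_mult_right integrable_normal_moment s)
    also have "(\<lambda>x. normal_density \<mu> s x * (x - \<mu>)\<^sup>2
        + 2 * \<mu> * (normal_density \<mu> s x * (x - \<mu>) ^ 1) + \<mu>\<^sup>2 * (normal_density \<mu> s x * (x - \<mu>) ^ 0))
      = (\<lambda>x. normal_density \<mu> s x * x\<^sup>2)"
      by (simp add: fun_eq_iff power2_eq_square algebra_simps)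
    finally show ?thesis
      using distributed_integrable[OF D, of "\<lambda>x. x\<^sup>2"] by simp
  qed
qed

text \<open>The integral is \<open>a / (a\<^sup>2 + q\<^sup>2)\<close>, read off from the explicit
  primitive \<open>?F\<close>, which tends to 0 at infinity; later only the sign matters.\<close>

lemma exp_cos_integral_nonneg:
  fixes a q :: real
  assumes a: "a > 0"
  shows "0 \<le> (LINT z:{0..}|lborel. exp (- a * z) * cos (q * z))"
proof -
  let ?f = "\<lambda>z. exp (- a * z) * cos (q * z)"
  let ?F = "\<lambda>z. exp (- a * z) * (q * sin (q * z) - a * cos (q * z)) / (a\<^sup>2 + q\<^sup>2)"
  have aq: "a\<^sup>2 + q\<^sup>2 > 0" using a by (simp add: add_pos_nonneg)
  have exp_int: "set_integrable lborel {0<..} (\<lambda>z. exp (- a * z))"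
    using integrable_I0i_exp_mscale[OF a] by (simp add: interval_lebesgue_integrable_def mult.commute)
  have int: "set_integrable lborel {0<..} ?f"
    by (rule set_integrable_bound[OF exp_int])
       (auto simp: set_borel_measurable_def abs_mult mult_left_le)
  have "(LBINT z=0..\<infinity>. ?f z) = 0 - (- a / (a\<^sup>2 + q\<^sup>2))"
  proof (rule interval_integral_FTC_integrable[where F = ?F])
    show "(?F has_vector_derivative ?f z) (at z)" for z
    proof -
      have "((\<lambda>z. exp (- a * z) * (q * sin (q * z) - a * cos (q * z)))
          has_real_derivative ?f z * (a\<^sup>2 + q\<^sup>2)) (at z)"
        by (auto intro!: derivative_eq_intros simp: algebra_simps power2_eq_square)
      from DERIV_cdivide[OF this, of "a\<^sup>2 + q\<^sup>2"] show ?thesis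
        using a by (simp add: has_real_derivative_iff_has_vector_derivative[symmetric])
    qed
    show "isCont ?f z" for z by (intro continuous_intros)
    show "set_integrable lborel (einterval 0 \<infinity>) ?f" using int by (simp add: zero_ereal_def)
    have "(?F \<longlongrightarrow> ?F 0) (at_right 0)" using aq by (intro tendsto_intros) auto
    thus "((?F \<circ> real_of_ereal) \<longlongrightarrow> - a / (a\<^sup>2 + q\<^sup>2)) (at_right 0)"
      by (simp add: zero_ereal_def ereal_tendsto_simps)
    have "(?F \<longlongrightarrow> 0) at_top"
    proof (rule Lim_null_comparison)
      show "\<forall>\<^sub>F z in at_top. norm (?F z) \<le> exp (- a * z) * ((\<bar>q\<bar> + a) / (a\<^sup>2 + q\<^sup>2))"
      proof (intro always_eventually allI)
        fix z
        have "\<bar>q * sin (q * z) - a * cos (q * z)\<bar> \<le> \<bar>q\<bar> * \<bar>sin (q * z)\<bar> + a * \<bar>cos (q * z)\<bar>"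
          using a abs_triangle_ineq4[of "q * sin (q * z)" "a * cos (q * z)"] by (simp add: abs_mult)
        also have "\<dots> \<le> \<bar>q\<bar> * 1 + a * 1"
          using a by (intro add_mono mult_left_mono) auto
        finally show "norm (?F z) \<le> exp (- a * z) * ((\<bar>q\<bar> + a) / (a\<^sup>2 + q\<^sup>2))"
          using aq by (simp add: abs_mult divide_right_mono)
      qed
      have "((\<lambda>z. exp (- a * z)) \<longlongrightarrow> 0) at_top"
        using a by (intro filterlim_compose[OF exp_at_bot]
            filterlim_tendsto_neg_mult_at_bot[OF tendsto_const _ filterlim_ident]) simp
      thus "((\<lambda>z. exp (- a * z) * ((\<bar>q\<bar> + a) / (a\<^sup>2 + q\<^sup>2))) \<longlongrightarrow> 0) at_top"
        by (rule tendsto_mult_left_zero)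
    qed
    thus "((?F \<circ> real_of_ereal) \<longlongrightarrow> 0) (at_left \<infinity>)" by (simp add: ereal_tendsto_simps)
  qed simp
  \<comment> \<open>The fundamental theorem was applied on the open half-line; the end point is a
    null set.\<close>
  moreover have "(LINT z:{0..}|lborel. ?f z) = (LINT z:{0<..}|lborel. ?f z)"
    by (intro set_integral_cong_set) (auto simp: set_borel_measurable_def AE_lborel_singleton
        intro!: eventually_mono[OF AE_lborel_singleton[of 0]])
  ultimately show ?thesis
    using a aq by (simp add: interval_lebesgue_integral_def zero_ereal_def)
qed

text \<open>A field that is measurable in \<open>\<omega>\<close> and continuous in \<open>x\<close> is jointly measurable, being the
  limit of its values at rational approximations of \<open>x\<close>.\<close>
lemma borel_measurable_random_section:
  fixes W :: "real \<Rightarrow> 'w \<Rightarrow> real"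
  assumes d: "d > 0"
    and meas: "\<And>x. x \<in> {0..d} \<Longrightarrow> W x \<in> borel_measurable M"
    and cont: "\<And>\<omega>. \<omega> \<in> space M \<Longrightarrow> continuous_on {0..d} (\<lambda>x. W x \<omega>)"
  shows "(\<lambda>(x, \<omega>). indicator {0..d} x * W x \<omega>) \<in> borel_measurable (lborel \<Otimes>\<^sub>M M)"
proof -
  \<comment> \<open>Grid points are clamped to \<open>[0, d]\<close>, where measurability and
    continuity of \<open>W\<close> are known; clamping leaves the limit unchanged for
    \<open>x\<close> in that interval.\<close>
  define r where "r n i = max 0 (min d (real_of_int i / real (Suc n)))" for n i
  define s where "s n x = r n \<lfloor>real (Suc n) * x\<rfloor>" for n x
  have r: "r n i \<in> {0..d}" for n i using d by (auto simp: r_def)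
  have lim: "(\<lambda>n. s n x) \<longlonglongrightarrow> x" if "x \<in> {0..d}" for x
  proof -
    have "(\<lambda>n. real_of_int \<lfloor>real (Suc n) * x\<rfloor> / real (Suc n)) \<longlonglongrightarrow> x"
    proof (rule LIM_zero_cancel, rule Lim_null_comparison)
      show "\<forall>\<^sub>F n in sequentially.
          norm (real_of_int \<lfloor>real (Suc n) * x\<rfloor> / real (Suc n) - x) \<le> inverse (real (Suc n))"
      proof (intro always_eventually allI)
        fix n
        have "real_of_int \<lfloor>real (Suc n) * x\<rfloor> / real (Suc n) - x
            = (real_of_int \<lfloor>real (Suc n) * x\<rfloor> - real (Suc n) * x) / real (Suc n)"
          by (simp add: field_simps del: of_nat_Suc)
        moreover have "\<bar>real_of_int \<lfloor>real (Suc n) * x\<rfloor> - real (Suc n) * x\<bar> \<le> 1" by linarith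
        ultimately show "norm (real_of_int \<lfloor>real (Suc n) * x\<rfloor> / real (Suc n) - x) \<le> inverse (real (Suc n))"
          by (simp add: divide_right_mono inverse_eq_divide del: of_nat_Suc)
      qed
      show "(\<lambda>n. inverse (real (Suc n))) \<longlonglongrightarrow> 0" by (rule LIMSEQ_inverse_real_of_nat)
    qed
    hence "(\<lambda>n. s n x) \<longlonglongrightarrow> max 0 (min d x)"
      unfolding s_def r_def by (intro tendsto_intros)
    thus ?thesis using that by simp
  qed
  show ?thesis
  proof (rule borel_measurable_LIMSEQ_real)
    show "(\<lambda>(x, \<omega>). indicator {0..d} x * W (s n x) \<omega>) \<in> borel_measurable (lborel \<Otimes>\<^sub>M M)" for n
    proof -
      \<comment> \<open>For fixed \<open>n\<close> the approximation takes only countably many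
        sections of \<open>W\<close>, selected by an integer that depends measurably on
        \<open>x\<close>.\<close>
      have "(\<lambda>p. W (r n \<lfloor>real (Suc n) * fst p\<rfloor>) (snd p)) \<in> borel_measurable (lborel \<Otimes>\<^sub>M M)"
      proof (rule measurable_compose_countable)
        show "(\<lambda>p. W (r n i) (snd p)) \<in> borel_measurable (lborel \<Otimes>\<^sub>M M)" for i
          by (rule measurable_compose[OF measurable_snd meas[OF r]])
        show "(\<lambda>p. \<lfloor>real (Suc n) * fst p\<rfloor>) \<in> measurable (lborel \<Otimes>\<^sub>M M) (count_space UNIV)"
          by measurable
      qed
      thus ?thesis unfolding s_def case_prod_beta by measurable
    qed
    fix p :: "real \<times> 'w" assume "p \<in> space (lborel \<Otimes>\<^sub>M M)"
    then obtain x \<omega> where p: "p = (x, \<omega>)" and \<omega>: "\<omega> \<in> space M" by (auto simp: space_pair_measure)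
    show "(\<lambda>n. (\<lambda>(x, \<omega>). indicator {0..d} x * W (s n x) \<omega>) p)
        \<longlonglongrightarrow> (\<lambda>(x, \<omega>). indicator {0..d} x * W x \<omega>) p"
    proof (cases "x \<in> {0..d}")
      case True
      have "(\<lambda>n. W (s n x) \<omega>) \<longlonglongrightarrow> W x \<omega>"
        by (rule continuous_on_tendsto_compose[OF cont[OF \<omega>] lim[OF True] True])
           (simp add: s_def r del: of_nat_Suc atLeastAtMost_iff)
      thus ?thesis using True by (simp add: p)
    qed (simp add: p)
  qed
qed

section \<open>Covariance and spectrum of the coupling coefficients\<close>

context
  fixes M :: "'w measure" and d a :: real and \<gamma>0 :: "real \<Rightarrow> real \<Rightarrow> real"
    and V :: "real \<Rightarrow> real \<Rightarrow> 'w \<Rightarrow> real"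
  assumes d: "d > 0" and field: "random_field M d a \<gamma>0 V"
begin

interpretation prob_space M using field by (simp add: random_field_def)

lemma random_field_gaussian: "x \<in> {0..d} \<Longrightarrow> 0 \<le> z \<Longrightarrow> gaussian_rv M (V x z)"
proof -
  assume xz: "x \<in> {0..d}" "0 \<le> z"
  have "gaussian_field M ({0..d} \<times> {0..}) (\<lambda>(x, z). V x z)"
    using field by (simp add: random_field_def)
  hence "gaussian_rv M (\<lambda>\<omega>. \<Sum>p\<in>{(x, z)}. 1 * (\<lambda>(x, z). V x z) p \<omega>)"
    unfolding gaussian_field_def using xz by (elim allE[of _ "{(x, z)}"] allE[of _ "\<lambda>_. 1"]) auto
  thus ?thesis by simp
qed

text \<open>The product of two coupling integrals is a double integral over the square
  \<open>[0, d] \<times> [0, d]\<close>. Fubini moves the expectation inside, where the covariance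
  separates into a kernel in \<open>x, y\<close> and an exponential in \<open>z\<close>.\<close>

lemma coupling_covariance:
  assumes f: "continuous_on UNIV f" and g: "continuous_on UNIV g" and z: "0 \<le> z"
  shows "expectation (\<lambda>\<omega>. coupling d V f g 0 \<omega> * coupling d V f g z \<omega>)
    = exp (- a * z) *
      (LINT x:{0..d}|lborel. (LINT y:{0..d}|lborel. \<gamma>0 x y * (f y * g y)) * (f x * g x))"
proof -
  let ?I = "indicator {0..d} :: real \<Rightarrow> real"
  let ?P = "lborel \<Otimes>\<^sub>M lborel :: (real \<times> real) measure"
  interpret PM: pair_sigma_finite ?P M by unfold_locales
  define h where "h x = f x * g x" for x
  have h: "continuous_on S h" for S
    unfolding h_def by (intro continuous_intros continuous_on_subset[OF f] continuous_on_subset[OF g]) auto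
  have [measurable]: "h \<in> borel_measurable borel" using h by (rule borel_measurable_continuous_onI)
  obtain H where H: "\<And>x. x \<in> {0..d} \<Longrightarrow> \<bar>h x\<bar> \<le> H"
    using compact_imp_bounded[OF compact_continuous_image[OF h compact_Icc[of 0 d]]]
    by (fastforce simp: bounded_iff)
  have H0: "0 \<le> H" using H[of 0] d by auto
  obtain C where "C-lipschitz_on ({0..d} \<times> {0..d}) (\<lambda>(x, y). \<gamma>0 x y)"
    using field unfolding random_field_def by blast
  hence \<gamma>_cont: "continuous_on ({0..d} \<times> {0..d}) (\<lambda>(x, y). \<gamma>0 x y)"
    by (rule lipschitz_on_continuous_on)
  obtain G where G: "\<And>x y. x \<in> {0..d} \<Longrightarrow> y \<in> {0..d} \<Longrightarrow> \<bar>\<gamma>0 x y\<bar> \<le> G"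
    using compact_imp_bounded[OF compact_continuous_image[OF \<gamma>_cont compact_Times[OF compact_Icc compact_Icc]]]
    by (force simp: bounded_iff)
  have G0: "0 \<le> G" using G[of 0 0] d by auto
  have V_meas: "V x t \<in> borel_measurable M" and V_sq: "integrable M (\<lambda>\<omega>. (V x t \<omega>)\<^sup>2)"
    if "x \<in> {0..d}" "0 \<le> t" for x t
    using random_field_gaussian[OF that] gaussian_rv_square_integrable[OF prob_space_axioms]
    by (auto simp: gaussian_rv_def)
  have V_sec: "continuous_on {0..d} (\<lambda>x. V x t \<omega>)" if "\<omega> \<in> space M" "0 \<le> t" for \<omega> t
  proof -
    have "continuous_on ({0..d} \<times> {0..}) (\<lambda>(x, z). V x z \<omega>)"
      using field that by (auto simp: random_field_def)
    moreover have "continuous_on {0..d} (\<lambda>x. (x, t))" by (intro continuous_intros)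
    moreover have "(\<lambda>x. (x, t)) ` {0..d} \<subseteq> {0..d} \<times> {0..}" using that by auto
    ultimately show ?thesis
      using continuous_on_compose2[of _ "\<lambda>(x, z). V x z \<omega>" "{0..d}" "\<lambda>x. (x, t)"] by simp
  qed
  have cov: "expectation (\<lambda>\<omega>. V x s \<omega> * V y t \<omega>) = \<gamma>0 x y * exp (- a * \<bar>s - t\<bar>)"
    if "x \<in> {0..d}" "y \<in> {0..d}" "0 \<le> s" "0 \<le> t" for x y s t
    using field that unfolding random_field_def by blast
  \<comment> \<open>Outside \<open>[0, d]\<close> nothing is known about \<open>V\<close>; cutting
    it off there gives a jointly measurable function on the whole line.\<close>
  define U where "U t x \<omega> = ?I x * V x t \<omega>" for t x \<omega>
  have U_meas: "(\<lambda>(x, \<omega>). U t x \<omega>) \<in> borel_measurable (lborel \<Otimes>\<^sub>M M)" if "0 \<le> t" for t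
    unfolding U_def by (rule borel_measurable_random_section[OF d V_meas[OF _ that] V_sec[OF _ that]])
  note [measurable] = U_meas[OF order_refl] U_meas[OF z]
  define F where "F = (\<lambda>(x, y) \<omega>. (h x * U 0 x \<omega>) * (h y * U z y \<omega>))"
  have [measurable]: "case_prod F \<in> borel_measurable (?P \<Otimes>\<^sub>M M)"
  proof -
    have 1: "(\<lambda>p. U 0 (fst (fst p)) (snd p)) \<in> borel_measurable (?P \<Otimes>\<^sub>M M)"
      using measurable_compose[of "\<lambda>p. (fst (fst p), snd p)" "?P \<Otimes>\<^sub>M M" "lborel \<Otimes>\<^sub>M M", OF _ U_meas[OF order_refl]]
      by simp
    have 2: "(\<lambda>p. U z (snd (fst p)) (snd p)) \<in> borel_measurable (?P \<Otimes>\<^sub>M M)"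
      using measurable_compose[of "\<lambda>p. (snd (fst p), snd p)" "?P \<Otimes>\<^sub>M M" "lborel \<Otimes>\<^sub>M M", OF _ U_meas[OF z]]
      by simp
    show ?thesis unfolding F_def case_prod_beta using 1 2 by measurable
  qed
  have F_out: "F (x, y) \<omega> = 0" if "\<not> (x \<in> {0..d} \<and> y \<in> {0..d})" for x y \<omega>
    using that by (auto simp: F_def U_def)
  have F_in: "F (x, y) \<omega> = h x * h y * (V x 0 \<omega> * V y z \<omega>)" if "x \<in> {0..d}" "y \<in> {0..d}" for x y \<omega>
    using that by (simp add: F_def U_def mult_ac)
  \<comment> \<open>The product is dominated by half the sum of the squares. Their expectations are
    \<open>\<gamma>0 x x\<close> and \<open>\<gamma>0 y y\<close>, since equal times make the
    exponential 1, and so \<open>G\<close> bounds them uniformly.\<close>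
  have VV: "integrable M (\<lambda>\<omega>. V x 0 \<omega> * V y z \<omega>)"
    and VV_le: "expectation (\<lambda>\<omega>. \<bar>V x 0 \<omega> * V y z \<omega>\<bar>) \<le> G"
    if xy: "x \<in> {0..d}" "y \<in> {0..d}" for x y
  proof -
    note [measurable] = V_meas[OF xy(1) order_refl] V_meas[OF xy(2) z]
    have ab: "\<bar>u * v\<bar> \<le> (u\<^sup>2 + v\<^sup>2) / 2" for u v :: real
      using sum_squares_bound[of "\<bar>u\<bar>" "\<bar>v\<bar>"] by (simp add: abs_mult)
    have I: "integrable M (\<lambda>\<omega>. ((V x 0 \<omega>)\<^sup>2 + (V y z \<omega>)\<^sup>2) / 2)"
      using V_sq[OF xy(1) order_refl] V_sq[OF xy(2) z] by simp
    show VV: "integrable M (\<lambda>\<omega>. V x 0 \<omega> * V y z \<omega>)"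
      by (rule Bochner_Integration.integrable_bound[OF I]) (use ab in auto)
    have "expectation (\<lambda>\<omega>. \<bar>V x 0 \<omega> * V y z \<omega>\<bar>) \<le> expectation (\<lambda>\<omega>. ((V x 0 \<omega>)\<^sup>2 + (V y z \<omega>)\<^sup>2) / 2)"
      using VV I by (intro integral_mono ab) auto
    also have "\<dots> = (\<gamma>0 x x + \<gamma>0 y y) / 2"
      using V_sq[OF xy(1) order_refl] V_sq[OF xy(2) z] cov[OF xy(1) xy(1), of 0 0] cov[OF xy(2) xy(2) z z]
      by (simp add: power2_eq_square)
    also have "\<dots> \<le> G" using G[OF xy(1) xy(1)] G[OF xy(2) xy(2)] by auto
    finally show "expectation (\<lambda>\<omega>. \<bar>V x 0 \<omega> * V y z \<omega>\<bar>) \<le> G" .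
  qed
  have int: "integrable (?P \<Otimes>\<^sub>M M) (case_prod F)"
  proof (rule PM.Fubini_integrable)
    show "AE p in ?P. integrable M (\<lambda>\<omega>. case_prod F (p, \<omega>))"
    proof (intro AE_I2)
      fix p :: "real \<times> real"
      obtain x y where p: "p = (x, y)" by fastforce
      show "integrable M (\<lambda>\<omega>. case_prod F (p, \<omega>))"
        using VV[of x y] by (cases "x \<in> {0..d} \<and> y \<in> {0..d}") (auto simp: p F_in F_out)
    qed
    have bd: "\<bar>expectation (\<lambda>\<omega>. \<bar>F p \<omega>\<bar>)\<bar> \<le> H * H * G * indicator ({0..d} \<times> {0..d}) p" for p
    proof -
      obtain x y where p: "p = (x, y)" by fastforce
      show ?thesis
      proof (cases "x \<in> {0..d} \<and> y \<in> {0..d}")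
        case True
        have "\<bar>h x * h y\<bar> \<le> H * H" unfolding abs_mult using H True H0 by (intro mult_mono) auto
        hence "\<bar>h x * h y\<bar> * expectation (\<lambda>\<omega>. \<bar>V x 0 \<omega> * V y z \<omega>\<bar>) \<le> H * H * G"
          using VV_le[of x y] True H0 by (intro mult_mono) auto
        moreover have "expectation (\<lambda>\<omega>. \<bar>F p \<omega>\<bar>) = \<bar>h x * h y\<bar> * expectation (\<lambda>\<omega>. \<bar>V x 0 \<omega> * V y z \<omega>\<bar>)"
          using True unfolding p by (simp add: F_in abs_mult[of "h x * h y"])
        ultimately show ?thesis using True by (simp add: p)
      qed (auto simp: p F_out)
    qed
    have "emeasure ?P ({0..d} \<times> {0..d}) < \<infinity>"
      using d by (subst lborel.emeasure_pair_measure_Times) (auto simp: ennreal_mult_less_top)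
    hence "integrable ?P (\<lambda>p. H * H * G * indicator ({0..d} \<times> {0..d}) p)"
      by (intro integrable_mult_right integrable_real_indicator) auto
    thus "integrable ?P (\<lambda>p. LINT \<omega>|M. norm (case_prod F (p, \<omega>)))"
      by (rule Bochner_Integration.integrable_bound) (use bd H0 G0 in \<open>auto intro!: AE_I2 simp: abs_mult\<close>)
  qed measurable
  have "expectation (\<lambda>\<omega>. coupling d V f g 0 \<omega> * coupling d V f g z \<omega>)
      = expectation (\<lambda>\<omega>. LINT p|?P. F p \<omega>)"
  proof (rule integral_cong_AE)
    show "AE \<omega> in M. coupling d V f g 0 \<omega> * coupling d V f g z \<omega> = (LINT p|?P. F p \<omega>)"
      using PM.AE_integrable_snd[OF int]
    proof eventually_elim
      case (elim \<omega>)
      have "coupling d V f g t \<omega> = (LINT x|lborel. h x * U t x \<omega>)" for t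
        by (simp add: coupling_def set_lebesgue_integral_def h_def U_def mult_ac)
      hence "coupling d V f g 0 \<omega> * coupling d V f g z \<omega>
          = (LINT x|lborel. LINT y|lborel. F (x, y) \<omega>)" by (simp add: F_def)
      also have "\<dots> = (LINT p|?P. F p \<omega>)" by (rule lborel_pair.integral_fst'[OF elim])
      finally show ?case .
    qed
    \<comment> \<open>The identity above holds only almost everywhere, so measurability of the
      coupling itself is obtained separately, as a parameter integral of a jointly measurable
      function.\<close>
    have "(\<lambda>\<omega>. LINT x|lborel. h x * U t x \<omega>) \<in> borel_measurable M" if "0 \<le> t" for t
    proof -
      have "(\<lambda>(x, \<omega>). h x * U t x \<omega>) \<in> borel_measurable (lborel \<Otimes>\<^sub>M M)"
        using U_meas[OF that] unfolding case_prod_beta by measurable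
      from measurable_compose[OF measurable_pair_swap' this]
      have "(\<lambda>(\<omega>, x). h x * U t x \<omega>) \<in> borel_measurable (M \<Otimes>\<^sub>M lborel)" by (simp add: case_prod_beta)
      thus ?thesis by (rule lborel.borel_measurable_lebesgue_integral)
    qed
    moreover have "coupling d V f g t = (\<lambda>\<omega>. LINT x|lborel. h x * U t x \<omega>)" for t
      by (simp add: fun_eq_iff coupling_def set_lebesgue_integral_def h_def U_def mult_ac)
    ultimately show "(\<lambda>\<omega>. coupling d V f g 0 \<omega> * coupling d V f g z \<omega>) \<in> borel_measurable M"
      using z by simp
    show "(\<lambda>\<omega>. LINT p|?P. F p \<omega>) \<in> borel_measurable M"
      using PM.integrable_snd[OF int] by simp
  qed
  also have "\<dots> = (LINT p|?P. expectation (F p))"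
    by (rule PM.Fubini_integral[OF int])
  also have "\<dots> = (LINT x|lborel. LINT y|lborel. expectation (F (x, y)))"
    by (rule lborel_pair.integral_fst'[symmetric]) (use PM.integrable_fst[OF int] in simp)
  also have "\<dots> = (LINT x|lborel. LINT y|lborel.
      exp (- a * z) * (?I x * (?I y * (\<gamma>0 x y * h y) * h x)))"
  proof (intro Bochner_Integration.integral_cong refl)
    fix x y
    show "expectation (F (x, y)) = exp (- a * z) * (?I x * (?I y * (\<gamma>0 x y * h y) * h x))"
    proof (cases "x \<in> {0..d} \<and> y \<in> {0..d}")
      case True
      have "F (x, y) = (\<lambda>\<omega>. h x * h y * (V x 0 \<omega> * V y z \<omega>))" using True by (simp add: F_in fun_eq_iff)
      hence "expectation (F (x, y)) = h x * h y * expectation (\<lambda>\<omega>. V x 0 \<omega> * V y z \<omega>)"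
        by simp
      thus ?thesis using True cov[of x y 0 z] z by simp
    next
      case False
      hence "F (x, y) = (\<lambda>\<omega>. 0)" using F_out by blast
      thus ?thesis using False by auto
    qed
  qed
  also have "\<dots> = exp (- a * z) *
      (LINT x:{0..d}|lborel. (LINT y:{0..d}|lborel. \<gamma>0 x y * h y) * h x)"
    by (simp add: set_lebesgue_integral_def)
  finally show ?thesis by (simp add: h_def)
qed

lemma coupling_spectrum_nonneg:
  assumes f: "continuous_on UNIV f" and g: "continuous_on UNIV g"
  shows "0 \<le> coupling_spectrum M d V f g q"
proof -
  define Q where
    "Q = (LINT x:{0..d}|lborel. (LINT y:{0..d}|lborel. \<gamma>0 x y * (f y * g y)) * (f x * g x))"
  have fg: "continuous_on S (\<lambda>x. f x * g x)" for S
    by (intro continuous_intros continuous_on_subset[OF f] continuous_on_subset[OF g]) auto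
  have "nonneg_operator_kernel d \<gamma>0" and a: "a > 0" using field by (auto simp: random_field_def)
  moreover have "(\<lambda>x. f x * g x) \<in> borel_measurable lborel"
    using borel_measurable_continuous_onI[OF fg] by simp
  moreover have "set_integrable lborel {0..d} (\<lambda>x. (f x * g x)\<^sup>2)"
    unfolding set_integrable_def
    by (intro borel_integrable_compact continuous_intros fg) simp
  \<comment> \<open>\<open>Q\<close> is the quadratic form of the covariance kernel at the product
    of \<open>f\<close> and \<open>g\<close>, which is square integrable because it is continuous on
    a compact interval.\<close>
  ultimately have Q: "0 \<le> Q" unfolding nonneg_operator_kernel_def Q_def by fastforce
  have "coupling_spectrum M d V f g q = (LINT z:{0..}|lborel. Q * (exp (- a * z) * cos (q * z)))"
    unfolding coupling_spectrum_def
    by (intro set_lebesgue_integral_cong) (auto simp: coupling_covariance[OF f g] Q_def)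
  also have "\<dots> = Q * (LINT z:{0..}|lborel. exp (- a * z) * cos (q * z))"
    by (rule set_integral_mult_right)
  finally show ?thesis using Q exp_cos_integral_nonneg[OF a, of q] by simp
qed

end

section \<open>The coefficients and the decay rate\<close>

text \<open>HOL extends \<open>sqrt\<close> to negative arguments as an odd function, so the sign of
  \<open>beta\<close> rests on the radicand: \<open>theta n1 \<le> 1\<close> bounds every root by
  \<open>n1 * k * d\<close>.\<close>

lemma beta_nonneg:
  assumes "d > 0" "n1 > 1" "k > 0" "s \<in> guided_roots d n1 k"
  shows "0 \<le> beta d n1 k s"
proof -
  have s: "0 < s" "s < n1 * k * d * theta n1" using assms(4) by (auto simp: guided_roots_def)
  have "theta n1 \<le> 1" unfolding theta_def by simp
  hence "n1 * k * d * theta n1 \<le> n1 * k * d" using assms by (intro mult_left_le) auto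
  hence "s \<le> n1 * k * d" using s by linarith
  hence "s / d \<le> n1 * k" using assms by (simp add: divide_le_eq)
  hence "(s / d)\<^sup>2 \<le> (n1 * k)\<^sup>2" using s assms by (intro power_mono) auto
  thus ?thesis by (simp add: beta_def power_divide power_mult_distrib)
qed

lemma continuous_guided_mode: "d > 0 \<Longrightarrow> continuous_on S (guided_mode d n1 k s)"
  unfolding guided_mode_def[abs_def] by (intro continuous_intros) auto

lemma continuous_radiating_mode: "d > 0 \<Longrightarrow> continuous_on S (radiating_mode d n1 k \<gamma>)"
  unfolding radiating_mode_def[abs_def] by (intro continuous_intros) auto

lemma coupling_spectrum_commute: "coupling_spectrum M d V f g q = coupling_spectrum M d V g f q"
  by (simp add: coupling_spectrum_def coupling_def mult.commute[of "f _"])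

lemma coupling_spectrum_minus: "coupling_spectrum M d V f g (- q) = coupling_spectrum M d V f g q"
  by (simp add: coupling_spectrum_def)

text \<open>Exchanging the modes reverses the sign of the wavenumber difference, which the even
  cosine does not see.\<close>

lemma transport_rate_commute: "transport_rate d n1 k \<sigma> M V j l = transport_rate d n1 k \<sigma> M V l j"
  using coupling_spectrum_minus[of M d V "guided_mode d n1 k (\<sigma> j)" "guided_mode d n1 k (\<sigma> l)"
      "beta d n1 k (\<sigma> l) - beta d n1 k (\<sigma> j)"]
  by (simp add: transport_rate_def mult_ac
      coupling_spectrum_commute[of M d V "guided_mode d n1 k (\<sigma> l)" "guided_mode d n1 k (\<sigma> j)"])

lemma transpose_Gamma_c: "transpose (Gamma_c d n1 k \<sigma> M V) = Gamma_c d n1 k \<sigma> M V"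
  by (auto simp: transpose_def Gamma_c_def vec_eq_iff intro: transport_rate_commute)

lemma Gamma_c_row_sum: "(\<Sum>l\<in>UNIV. Gamma_c d n1 k \<sigma> M V $ j $ l) = 0"
proof -
  have "(\<Sum>l\<in>UNIV. Gamma_c d n1 k \<sigma> M V $ j $ l)
      = Gamma_c d n1 k \<sigma> M V $ j $ j + (\<Sum>l\<in>UNIV - {j}. Gamma_c d n1 k \<sigma> M V $ j $ l)"
    by (simp add: sum.remove[of UNIV j])
  also have "(\<Sum>l\<in>UNIV - {j}. Gamma_c d n1 k \<sigma> M V $ j $ l)
      = (\<Sum>l\<in>UNIV - {j}. transport_rate d n1 k \<sigma> M V j l)"
    by (intro sum.cong) (auto simp: Gamma_c_def)
  finally show ?thesis by (simp add: Gamma_c_def)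
qed

lemma Gamma_c_offdiag_nonneg:
  assumes "d > 0" "n1 > 1" "k > 0" "range \<sigma> \<subseteq> guided_roots d n1 k"
    and "random_field M d a \<gamma>0 V" and "j \<noteq> l"
  shows "0 \<le> Gamma_c d n1 k \<sigma> M V $ j $ l"
proof -
  have "0 \<le> beta d n1 k (\<sigma> i)" for i using assms by (intro beta_nonneg) auto
  moreover have "0 \<le> coupling_spectrum M d V (guided_mode d n1 k (\<sigma> j)) (guided_mode d n1 k (\<sigma> l)) q" for q
    using assms by (intro coupling_spectrum_nonneg continuous_guided_mode)
  ultimately show ?thesis using assms(3,6) by (simp add: Gamma_c_def transport_rate_def)
qed

lemma Lambda_c_nonneg:
  assumes "d > 0" "n1 > 1" "k > 0" "range \<sigma> \<subseteq> guided_roots d n1 k"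
    and "random_field M d a \<gamma>0 V"
  shows "0 \<le> Lambda_c d n1 k \<sigma> M V $ j"
proof -
  have "0 \<le> beta d n1 k (\<sigma> j)" using assms by (intro beta_nonneg) auto
  moreover have "0 \<le> coupling_spectrum M d V (guided_mode d n1 k (\<sigma> j)) (radiating_mode d n1 k \<gamma>) q" for q \<gamma>
    using assms by (intro coupling_spectrum_nonneg continuous_guided_mode continuous_radiating_mode)
  \<comment> \<open>Pointwise nonnegativity settles the sign in every case, as a non-integrable
    integrand would receive the default value 0.\<close>
  ultimately show ?thesis
    unfolding Lambda_c_def set_lebesgue_integral_def using assms(3)
    by (auto intro!: Bochner_Integration.integral_nonneg simp: indicator_def)
qed

theorem theorem5p1:
  fixes d n1 k a :: real
    and \<sigma> :: "'n::{finite,linorder} \<Rightarrow> real"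
    and M :: "'w measure"
    and \<gamma>0 :: "real \<Rightarrow> real \<Rightarrow> real"
    and V :: "real \<Rightarrow> real \<Rightarrow> 'w \<Rightarrow> real"
    and T :: "'n \<Rightarrow> real \<Rightarrow> real ^ 'n::{finite,linorder}"
  assumes "d > 0" and "n1 > 1" and "k > 0"
    and "strict_mono \<sigma>" and "range \<sigma> = guided_roots d n1 k"
    and "random_field M d a \<gamma>0 V"
    and "\<And>l. solves_coupled_power_equations
               (Gamma_c d n1 k \<sigma> M V) (Lambda_c d n1 k \<sigma> M V) l (T l)"
    and "irreducible_matrix (Gamma_c d n1 k \<sigma> M V)"
  shows "(\<forall>l. ((\<lambda>L. 1 / L * ln (\<Sum>j\<in>UNIV. T l L $ j))
                \<longlongrightarrow> - Lambda_inf (Gamma_c d n1 k \<sigma> M V) (Lambda_c d n1 k \<sigma> M V)) at_top)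
       \<and> ((\<exists>j. Lambda_c d n1 k \<sigma> M V $ j > 0)
            \<longrightarrow> Lambda_inf (Gamma_c d n1 k \<sigma> M V) (Lambda_c d n1 k \<sigma> M V) > 0)"
proof -
  let ?\<Gamma> = "Gamma_c d n1 k \<sigma> M V" and ?\<Lambda> = "Lambda_c d n1 k \<sigma> M V"
  define A where "A = ?\<Gamma> - diag_matrix ?\<Lambda>"
  have sub: "range \<sigma> \<subseteq> guided_roots d n1 k" using assms(5) by simp
  have \<Gamma>_sym: "?\<Gamma> $ i $ j = ?\<Gamma> $ j $ i" for i j
    using transpose_Gamma_c[of d n1 k \<sigma> M V] by (simp add: transpose_def vec_eq_iff)
  have sym: "transpose A = A"
    using \<Gamma>_sym by (auto simp: A_def transpose_def diag_matrix_def vec_eq_iff)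
  have A_off: "A $ i $ j = ?\<Gamma> $ i $ j" if "i \<noteq> j" for i j
    using that by (simp add: A_def diag_matrix_def)
  have metzler: "0 \<le> A $ i $ j" if "i \<noteq> j" for i j
    using Gamma_c_offdiag_nonneg[OF assms(1-3) sub assms(6) that] A_off[OF that] by simp
  \<comment> \<open>Irreducibility only inspects entries between a set and its complement, which are
    off-diagonal and so shared by \<open>A\<close> and \<open>?\<Gamma>\<close>.\<close>
  have irr: "irreducible_matrix A"
    unfolding irreducible_matrix_def
  proof
    assume "\<exists>S. S \<noteq> {} \<and> S \<noteq> UNIV \<and> (\<forall>i\<in>S. \<forall>j\<in>- S. A $ i $ j = 0)"
    then obtain S where S: "S \<noteq> {}" "S \<noteq> UNIV" "\<And>i j. i \<in> S \<Longrightarrow> j \<in> - S \<Longrightarrow> A $ i $ j = 0" by blast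
    have "?\<Gamma> $ i $ j = 0" if "i \<in> S" "j \<in> - S" for i j
      using S(3)[OF that] A_off[of i j] that by auto
    thus False using assms(8) S(1,2) unfolding irreducible_matrix_def by blast
  qed
  have A_apply: "(A *v y) $ j = (\<Sum>n\<in>UNIV. ?\<Gamma> $ j $ n * y $ n) - ?\<Lambda> $ j * y $ j" for y j
    by (simp add: A_def matrix_vector_mult_def diag_matrix_def left_diff_distrib sum_subtractf
        if_distrib[of "\<lambda>t. t * _"] cong: if_cong)
  define \<mu> where "\<mu> = - Lambda_inf ?\<Gamma> ?\<Lambda>"
  have \<mu>: "- (INF X\<in>nonneg_sphere. ((- A) *v X) \<bullet> X) = \<mu>"
    by (simp add: \<mu>_def Lambda_inf_def A_def)
  obtain x where x: "\<And>j. 0 < x $ j" "A *v x = \<mu> *\<^sub>R x" "\<And>y. (A *v y) \<bullet> y \<le> \<mu> * (y \<bullet> y)"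
    using perron_eigenvector[OF sym metzler irr] unfolding \<mu> by blast
  have "((\<lambda>L. 1 / L * ln (\<Sum>j\<in>UNIV. T l L $ j)) \<longlongrightarrow> \<mu>) at_top" for l
  proof (rule metzler_flow_growth_rate[OF sym metzler x])
    show "((\<lambda>z. T l z $ j) has_real_derivative (A *v T l z) $ j) (at z within {0..})"
      if "0 \<le> z" for z j
    proof -
      \<comment> \<open>The term \<open>n = j\<close> is zero and may be added; symmetry and the
        vanishing row sums then turn the exchange terms into \<open>?\<Gamma>\<close> applied to
        \<open>T l z\<close>.\<close>
      have "(\<Sum>n\<in>UNIV - {j}. ?\<Gamma> $ n $ j * (T l z $ n - T l z $ j))
          = (\<Sum>n\<in>UNIV. ?\<Gamma> $ n $ j * (T l z $ n - T l z $ j))"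
        by (simp add: sum.remove[of UNIV j])
      also have "\<dots> = (\<Sum>n\<in>UNIV. ?\<Gamma> $ j $ n * T l z $ n) - (\<Sum>n\<in>UNIV. ?\<Gamma> $ j $ n) * T l z $ j"
        by (simp add: \<Gamma>_sym[of _ j] right_diff_distrib sum_subtractf sum_distrib_right)
      finally have eq: "- ?\<Lambda> $ j * T l z $ j + (\<Sum>n\<in>UNIV - {j}. ?\<Gamma> $ n $ j * (T l z $ n - T l z $ j))
          = (A *v T l z) $ j"
        by (simp add: A_apply Gamma_c_row_sum)
      show ?thesis
        using assms(7)[of l] that unfolding solves_coupled_power_equations_def eq[symmetric] by blast
    qed
    have T0: "T l 0 $ j = (if j = l then 1 else 0)" for j
      using assms(7)[of l] unfolding solves_coupled_power_equations_def by blast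
    show "0 \<le> T l 0 $ j" for j by (simp add: T0)
    show "T l 0 \<noteq> 0" using T0[of l] by auto
  qed
  moreover have "0 < Lambda_inf ?\<Gamma> ?\<Lambda>" if "?\<Lambda> $ j0 > 0" for j0
  proof -
    have "\<mu> * (\<Sum>j\<in>UNIV. x $ j) = (\<Sum>j\<in>UNIV. (A *v x) $ j)"
      by (simp add: x(2) sum_distrib_left)
    also have "\<dots> = (\<Sum>j\<in>UNIV. \<Sum>n\<in>UNIV. ?\<Gamma> $ j $ n * x $ n) - (\<Sum>j\<in>UNIV. ?\<Lambda> $ j * x $ j)"
      by (simp add: A_apply sum_subtractf)
    also have "(\<Sum>j\<in>UNIV. \<Sum>n\<in>UNIV. ?\<Gamma> $ j $ n * x $ n) = (\<Sum>n\<in>UNIV. (\<Sum>j\<in>UNIV. ?\<Gamma> $ n $ j) * x $ n)"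
      by (subst sum.swap) (simp add: sum_distrib_right \<Gamma>_sym)
    finally have "\<mu> * (\<Sum>j\<in>UNIV. x $ j) = - (\<Sum>j\<in>UNIV. ?\<Lambda> $ j * x $ j)"
      by (simp add: Gamma_c_row_sum)
    \<comment> \<open>One positive coefficient suffices because every entry of \<open>x\<close> is
      strictly positive, in particular the one at \<open>j0\<close>.\<close>
    moreover have "0 < (\<Sum>j\<in>UNIV. ?\<Lambda> $ j * x $ j)"
      using that x(1) Lambda_c_nonneg[OF assms(1-3) sub assms(6)]
      by (intro sum_pos2[of _ j0]) (auto intro: mult_nonneg_nonneg less_imp_le[OF x(1)])
    moreover have "0 < (\<Sum>j\<in>UNIV. x $ j)" using x(1) by (intro sum_pos) auto
    ultimately have "\<mu> < 0"
      using mult_less_0_iff[of \<mu> "\<Sum>j\<in>UNIV. x $ j"] by linarith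
    thus ?thesis by (simp add: \<mu>_def)
  qed
  ultimately show ?thesis unfolding \<mu>_def by blast
qed

end
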